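(* Let $\Delta>0$, $\nu=\delta_0\otimes\mathcal{N}(-\Delta,1)$ and $\nu'=\delta_0\otimes\mathcal{N}(\Delta,1)$. Then for any policy, and any $n\ge1$, $$\max\big(R_n(\nu),R_n(\nu')\big)\ge\frac{\log(n\Delta^2/2)}{4\Delta}.$$
   Context: Two-armed stochastic bandit: for a product distribution $\nu=\nu_1\otimes\nu_2$, successive pulls of arm $j\in\{1,2\}$ yield i.i.d. rewards with distribution $\nu_j$ and mean $\mu^{(j)}$, independently across arms. A policy is a sequence of random variables $I_t\in\{1,2\}$ (the arm pulled at time $t$), where $I_t$ depends only on the rewards observed strictly before time $t$; only the reward of the pulled arm is observed. The regret of the policy when the rewards are generated by $\nu$ is $R_n(\nu)=n\max(\mu^{(1)},\mu^{(2)})-\sum_{t=1}^n\mathbb{E}_\nu\,\mu^{(I_t)}$. $\mathcal{N}(m,1)$ is the Gaussian distribution with mean $m$ and variance 1, and $\delta_0$ is the Dirac mass at $0$. *)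

theory Defs
  imports "HOL-Probability.Probability"
begin

datatype arm = Arm1 | Arm2

(* An outcome is a table of rewards: w (j, k) is the reward that the pull of arm j made after
   k earlier pulls of j yields. Only the entries that are actually reached are observed. *)
type_synonym table = "arm \<times> nat \<Rightarrow> real"

definition bandit_measure :: "(arm \<Rightarrow> real measure) \<Rightarrow> table measure" where
  "bandit_measure \<nu> = (\<Pi>\<^sub>M p\<in>UNIV. \<nu> (fst p))"

(* Rounds are numbered from 1; the value at round 0 of a policy is never used. *)
definition pulls_before :: "(nat \<Rightarrow> table \<Rightarrow> arm) \<Rightarrow> arm \<Rightarrow> nat \<Rightarrow> table \<Rightarrow> nat" where
  "pulls_before I j t w = card {s \<in> {1..<t}. I s w = j}"

definition observed :: "(nat \<Rightarrow> table \<Rightarrow> arm) \<Rightarrow> nat \<Rightarrow> table \<Rightarrow> real" where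
  "observed I t w = w (I t w, pulls_before I (I t w) t w)"

definition history :: "(nat \<Rightarrow> table \<Rightarrow> arm) \<Rightarrow> nat \<Rightarrow> table \<Rightarrow> nat \<Rightarrow> real" where
  "history I t w = (\<lambda>s\<in>{1..<t}. observed I s w)"

(* The arm chosen at round t is measurable with respect to the sigma-algebra generated by the
   rewards observed at rounds 1, ..., t - 1. The arms chosen in these rounds are then determined
   by the same rewards. The notion does not involve the reward distributions. *)
definition policy :: "(nat \<Rightarrow> table \<Rightarrow> arm) \<Rightarrow> bool" where
  "policy I \<longleftrightarrow>
     (\<forall>t\<ge>1. I t \<in> vimage_algebra UNIV (history I t) (\<Pi>\<^sub>M s\<in>{1..<t}. borel)
                    \<rightarrow>\<^sub>M count_space UNIV)"

definition mean :: "real measure \<Rightarrow> real" where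
  "mean M = (\<integral>x. x \<partial>M)"

definition regret :: "(arm \<Rightarrow> real measure) \<Rightarrow> (nat \<Rightarrow> table \<Rightarrow> arm) \<Rightarrow> nat \<Rightarrow> real" where
  "regret \<nu> I n =
     real n * max (mean (\<nu> Arm1)) (mean (\<nu> Arm2))
       - (\<Sum>t=1..n. \<integral>w. mean (\<nu> (I t w)) \<partial>bandit_measure \<nu>)"

definition two_arms :: "real measure \<Rightarrow> real measure \<Rightarrow> arm \<Rightarrow> real measure" where
  "two_arms \<nu>1 \<nu>2 j = (case j of Arm1 \<Rightarrow> \<nu>1 | Arm2 \<Rightarrow> \<nu>2)"

definition gaussian :: "real \<Rightarrow> real measure" where
  "gaussian m = density lborel (\<lambda>x. ennreal (normal_density m 1 x))"

definition dirac0 :: "real measure" where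
  "dirac0 = return borel 0"

end

(* Under nu the regret is \<Delta> times the expected number of pulls of the second arm, under nu' it is
   \<Delta> times the expected number of pulls of the first one, so in each round the policy faces the
   problem of testing nu against nu'. The law of the rewards observed before round t under nu' has
   density exp (2 \<Delta> S) with respect to the one under nu, where S is the sum of the rewards
   obtained from the second arm. By Wald's identity its Kullback-Leibler divergence is 2 \<Delta>^2 times
   the expected number of pulls of the second arm, which is at most 2 \<Delta> R, R being the larger
   regret. The Bretagnolle-Huber inequality in each round and summation over the rounds give
   4 R >= n \<Delta> exp (- 2 \<Delta> R), and the claim follows from 2 \<Delta> R <= exp (2 \<Delta> R). *)

theory Submission
  imports Defs
begin


section \<open>Product measures: finite marginals, densities, independence of coordinates\<close>

text \<open>Allows a function of a full table to be integrated over a finite product. The points of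
  \<open>PiM J N\<close> have the constant value \<open>undefined\<close> outside \<open>J\<close>,
  which is harmless because every factor has the whole type as its space.\<close>

lemma measurable_PiM_UNIV_extend:
  fixes N :: "'i \<Rightarrow> 'b::topological_space measure"
  assumes "\<And>i. sets (N i) = sets borel"
  shows "(\<lambda>x. x) \<in> PiM J N \<rightarrow>\<^sub>M PiM UNIV N"
proof (rule measurable_PiM_single')
  have sp: "space (N i) = UNIV" for i
    using sets_eq_imp_space_eq[OF assms, of i] by simp
  show "(\<lambda>x. x i) \<in> PiM J N \<rightarrow>\<^sub>M N i" for i
  proof (cases "i \<in> J")
    case False
    then have "x i = undefined" if "x \<in> space (PiM J N)" for x
      using that by (auto simp: space_PiM PiE_def extensional_def)
    then have "(\<lambda>x. x i) \<in> PiM J N \<rightarrow>\<^sub>M N i \<longleftrightarrow> (\<lambda>x. undefined) \<in> PiM J N \<rightarrow>\<^sub>M N i"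
      by (intro measurable_cong) auto
    then show ?thesis
      by (simp add: sp)
  qed simp
  show "(\<lambda>x i. x i) \<in> space (PiM J N) \<rightarrow> (\<Pi>\<^sub>E i\<in>UNIV. space (N i))"
    by (auto simp: sp)
qed

lemma borel_measurable_PiM_subset:
  fixes N :: "'i \<Rightarrow> 'b::topological_space measure"
  assumes "\<And>i. sets (N i) = sets borel" and f: "f \<in> borel_measurable (PiM UNIV N)"
  shows "f \<in> borel_measurable (PiM J N)"
  by (rule measurable_compose[OF measurable_PiM_UNIV_extend f]) fact

text \<open>The finite product is the image of the full one under restriction to \<open>J\<close>,
  and \<open>f\<close> does not notice the restriction.\<close>

lemma nn_integral_PiM_restrict:
  fixes N :: "'i \<Rightarrow> 'b::topological_space measure"
  assumes "\<And>i. prob_space (N i)" "\<And>i. sets (N i) = sets borel" "finite J"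
    and f: "f \<in> borel_measurable (PiM UNIV N)" and dep: "\<And>w. f (restrict w J) = f w"
  shows "(\<integral>\<^sup>+w. f w \<partial>PiM UNIV N) = (\<integral>\<^sup>+x. f x \<partial>PiM J N)"
proof -
  interpret product_prob_space N UNIV
    by (rule product_prob_spaceI) fact
  have [measurable]: "f \<in> borel_measurable (PiM J N)"
    by (rule borel_measurable_PiM_subset[OF assms(2) f])
  have "(\<integral>\<^sup>+x. f x \<partial>PiM J N) = (\<integral>\<^sup>+x. f x \<partial>distr (PiM UNIV N) (PiM J N) (\<lambda>x. restrict x J))"
    using \<open>finite J\<close> by (simp add: distr_PiM_restrict_finite)
  also have "\<dots> = (\<integral>\<^sup>+w. f (restrict w J) \<partial>PiM UNIV N)"
    by (intro nn_integral_distr measurable_restrict_subset) auto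
  finally show ?thesis
    by (simp add: dep)
qed

text \<open>A finite product is determined by its values on boxes, and there the integral of the
  product density splits into one-dimensional integrals.\<close>

lemma PiM_density:
  fixes N :: "'i \<Rightarrow> 'b measure" and l :: "'i \<Rightarrow> 'b \<Rightarrow> ennreal"
  assumes "\<And>i. prob_space (N i)" "finite J"
    and l[measurable]: "\<And>i. l i \<in> borel_measurable (N i)" and "\<And>i. prob_space (density (N i) (l i))"
  shows "PiM J (\<lambda>i. density (N i) (l i)) = density (PiM J N) (\<lambda>x. \<Prod>i\<in>J. l i (x i))"
proof -
  interpret N: product_prob_space N J
    by (rule product_prob_spaceI) fact
  interpret D: product_prob_space "\<lambda>i. density (N i) (l i)" J
    by (rule product_prob_spaceI) fact
  have "density (PiM J N) (\<lambda>x. \<Prod>i\<in>J. l i (x i)) = PiM J (\<lambda>i. density (N i) (l i))"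
  proof (rule D.PiM_eqI)
    show "sets (density (PiM J N) (\<lambda>x. \<Prod>i\<in>J. l i (x i))) = sets (PiM J (\<lambda>i. density (N i) (l i)))"
      by (simp cong: sets_PiM_cong)
    fix A assume "\<And>i. i \<in> J \<Longrightarrow> A i \<in> sets (density (N i) (l i))"
    then have [measurable]: "i \<in> J \<Longrightarrow> A i \<in> sets (N i)" for i
      by simp
    have ind: "indicator (Pi\<^sub>E J A) x = (\<Prod>i\<in>J. indicator (A i) (x i) :: ennreal)"
      if "x \<in> space (PiM J N)" for x
      using that \<open>finite J\<close>
      by (cases "\<forall>i\<in>J. x i \<in> A i") (auto simp: indicator_def space_PiM PiE_iff prod_zero_iff)
    have "emeasure (density (PiM J N) (\<lambda>x. \<Prod>i\<in>J. l i (x i))) (Pi\<^sub>E J A)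
        = (\<integral>\<^sup>+x. (\<Prod>i\<in>J. l i (x i)) * indicator (Pi\<^sub>E J A) x \<partial>PiM J N)"
      using \<open>finite J\<close> by (intro emeasure_density) (auto intro!: sets_PiM_I_finite)
    also have "\<dots> = (\<integral>\<^sup>+x. (\<Prod>i\<in>J. l i (x i) * indicator (A i) (x i)) \<partial>PiM J N)"
      by (intro nn_integral_cong) (simp add: ind prod.distrib)
    also have "\<dots> = (\<Prod>i\<in>J. \<integral>\<^sup>+x. l i x * indicator (A i) x \<partial>N i)"
      using \<open>finite J\<close> by (intro N.product_nn_integral_prod) auto
    also have "\<dots> = (\<Prod>i\<in>J. emeasure (density (N i) (l i)) (A i))"
      by (intro prod.cong refl emeasure_density[symmetric]) auto
    finally show "emeasure (density (PiM J N) (\<lambda>x. \<Prod>i\<in>J. l i (x i))) (Pi\<^sub>E J A)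
        = (\<Prod>i\<in>J. emeasure (density (N i) (l i)) (A i))" .
  qed fact
  then show ?thesis ..
qed

text \<open>The infinite products need not have a density with respect to each other. For an
  integrand that sees only the coordinates in \<open>J\<close> the detour through the finite product
  over \<open>J\<close> provides one.\<close>

lemma nn_integral_PiM_change_of_measure:
  fixes N :: "'i \<Rightarrow> 'b::topological_space measure" and l :: "'i \<Rightarrow> 'b \<Rightarrow> ennreal"
  assumes N: "\<And>i. prob_space (N i)" "\<And>i. sets (N i) = sets borel" "finite J"
    and l[measurable]: "\<And>i. l i \<in> borel_measurable borel" and D: "\<And>i. prob_space (density (N i) (l i))"
    and f[measurable]: "f \<in> borel_measurable (PiM UNIV (\<lambda>_. borel))" and dep: "\<And>w. f (restrict w J) = f w"
  shows "(\<integral>\<^sup>+w. f w \<partial>PiM UNIV (\<lambda>i. density (N i) (l i)))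
       = (\<integral>\<^sup>+w. (\<Prod>i\<in>J. l i (w i)) * f w \<partial>PiM UNIV N)"
proof -
  note N(2)[measurable_cong]
  have [measurable]: "l i \<in> borel_measurable (N i)" for i
    by simp
  have [measurable_cong]: "sets (PiM UNIV N) = sets (PiM UNIV (\<lambda>_. borel))"
    "sets (PiM UNIV (\<lambda>i. density (N i) (l i))) = sets (PiM UNIV (\<lambda>_. borel))"
    using N(2) by (auto cong: sets_PiM_cong)
  have fJ[measurable]: "f \<in> borel_measurable (PiM J N)"
    by (rule borel_measurable_PiM_subset[OF N(2)]) measurable
  have "(\<integral>\<^sup>+w. f w \<partial>PiM UNIV (\<lambda>i. density (N i) (l i))) = (\<integral>\<^sup>+x. f x \<partial>PiM J (\<lambda>i. density (N i) (l i)))"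
    using N D dep by (intro nn_integral_PiM_restrict) auto
  also have "\<dots> = (\<integral>\<^sup>+x. (\<Prod>i\<in>J. l i (x i)) * f x \<partial>PiM J N)"
    using N D by (subst PiM_density) (auto intro!: nn_integral_density)
  also have "\<dots> = (\<integral>\<^sup>+w. (\<Prod>i\<in>J. l i (w i)) * f w \<partial>PiM UNIV N)"
    using N dep by (intro nn_integral_PiM_restrict[symmetric]) auto
  finally show ?thesis .
qed

lemma indep_vars_PiM_coordinates:
  assumes "\<And>i. prob_space (N i)"
  shows "prob_space.indep_vars (PiM UNIV N) N (\<lambda>i w. w i) UNIV"
proof -
  interpret product_prob_space N UNIV
    by (rule product_prob_spaceI) fact
  have "(\<Pi>\<^sub>M i\<in>UNIV. distr (PiM UNIV N) (N i) (\<lambda>w. w i)) = PiM UNIV N"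
    by (intro PiM_cong refl PiM_component) auto
  then show ?thesis
    by (subst indep_vars_iff_distr_eq_PiM) (auto simp: restrict_UNIV)
qed

text \<open>The coordinate \<open>p\<close> is independent of everything that is determined by the
  coordinates in \<open>J\<close>. This is the single step of Wald's identity.\<close>

lemma
  fixes N :: "'i \<Rightarrow> 'b::topological_space measure" and f :: "('i \<Rightarrow> 'b) \<Rightarrow> real" and h :: "'b \<Rightarrow> real"
  assumes N: "\<And>i. prob_space (N i)" "\<And>i. sets (N i) = sets borel" and "p \<notin> J"
    and dep: "\<And>w. f (restrict w J) = f w"
    and f: "integrable (PiM UNIV N) f" and h: "integrable (N p) h"
  shows integrable_PiM_mult_coordinate: "integrable (PiM UNIV N) (\<lambda>w. f w * h (w p))"
    and integral_PiM_mult_coordinate: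
      "(\<integral>w. f w * h (w p) \<partial>PiM UNIV N) = (\<integral>w. f w \<partial>PiM UNIV N) * (\<integral>x. h x \<partial>N p)"
proof -
  interpret product_prob_space N UNIV
    by (rule product_prob_spaceI) fact
  have comp: "distr (PiM UNIV N) (N p) (\<lambda>w. w p) = N p"
    by (rule PiM_component) simp
  have [measurable]: "f \<in> borel_measurable (PiM UNIV N)" "h \<in> borel_measurable (N p)"
    using f h by auto
  have fJ[measurable]: "f \<in> borel_measurable (PiM J N)"
    by (rule borel_measurable_PiM_subset[OF N(2)]) measurable
  have "indep_var (PiM J N) (\<lambda>w. restrict (\<lambda>i. w i) J) (PiM {p} N) (\<lambda>w. restrict (\<lambda>i. w i) {p})"
    using indep_vars_PiM_coordinates[of N, OF N(1)] \<open>p \<notin> J\<close>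
    by (intro indep_var_restrict) auto
  then have "indep_var borel (f \<circ> (\<lambda>w. restrict (\<lambda>i. w i) J)) borel ((\<lambda>x. h (x p)) \<circ> (\<lambda>w. restrict (\<lambda>i. w i) {p}))"
    by (rule indep_var_compose) auto
  then have ind: "indep_var borel f borel (\<lambda>w. h (w p))"
    by (simp add: comp_def dep)
  have hp: "integrable (PiM UNIV N) (\<lambda>w. h (w p))"
    using h comp integrable_distr_eq[of "\<lambda>w. w p" "PiM UNIV N" "N p" h] by simp
  have ih: "(\<integral>w. h (w p) \<partial>PiM UNIV N) = (\<integral>x. h x \<partial>N p)"
    using comp integral_distr[of "\<lambda>w. w p" "PiM UNIV N" "N p" h] by simp
  show "integrable (PiM UNIV N) (\<lambda>w. f w * h (w p))"
    using indep_var_integrable[OF ind f hp] .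
  show "(\<integral>w. f w * h (w p) \<partial>PiM UNIV N) = (\<integral>w. f w \<partial>PiM UNIV N) * (\<integral>x. h x \<partial>N p)"
    using indep_var_lebesgue_integral[OF ind f hp] by (simp add: ih)
qed

section \<open>The Bretagnolle-Huber inequality\<close>

(* AM-GM for min 1 (exp x) and max 1 (exp x), whose product is exp x. *)
lemma exp_half_le:
  fixes x c :: real
  assumes "c > 0"
  shows "2 * exp (x / 2) \<le> c * min 1 (exp x) + (1 + exp x) / c"
proof -
  define u where "u = exp (x / 2)"
  have u: "u > 0" "exp x = u * u"
    by (simp_all add: u_def flip: exp_add)
  have "2 * u \<le> c * m + M / c" if "m * M = u * u" "m \<ge> 0" "M \<ge> 0" for m M
  proof -
    have "0 \<le> (c * m - M / c)\<^sup>2"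
      by simp
    also have "\<dots> = (c * m + M / c)\<^sup>2 - 4 * (m * M)"
      using assms by (simp add: power2_eq_square field_simps)
    finally have "(2 * u)\<^sup>2 \<le> (c * m + M / c)\<^sup>2"
      by (simp add: that power2_eq_square)
    then show ?thesis
      using assms that by (intro power2_le_imp_le[of "2 * u"]) auto
  qed
  from this[of "min 1 (exp x)" "max 1 (exp x)"] have "2 * u \<le> c * min 1 (exp x) + max 1 (exp x) / c"
    by (auto simp: u min_def max_def)
  \<comment> \<open>The sum is cruder than the maximum, but for a likelihood ratio
    \<open>exp x\<close> its expectation is exactly 2.\<close>
  also have "max 1 (exp x) / c \<le> (1 + exp x) / c"
    using assms by (intro divide_right_mono) auto
  finally show ?thesis
    by (simp add: u_def)
qed

(* The classical argument with Cauchy-Schwarz and Jensen, in a pointwise form: Jensen is replaced by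
   the tangent to exp at - K / 2, Cauchy-Schwarz by AM-GM with the weight c below. *)
lemma (in prob_space) bretagnolle_huber:
  fixes X :: "'a \<Rightarrow> real"
  assumes X: "integrable M X" "expectation X = - K"
    and eX: "integrable M (\<lambda>w. exp (X w))" "expectation (\<lambda>w. exp (X w)) = 1"
    and A: "A \<in> events"
  shows "exp (- K) / 2 \<le> prob A + expectation (\<lambda>w. exp (X w) * indicator (space M - A) w)"
proof -
  define m where "m = prob A + expectation (\<lambda>w. exp (X w) * indicator (space M - A) w)"
  \<comment> \<open>Integrating the pointwise bound gives
    \<open>2 * exp (- K / 2) \<le> c * m + 2 / c\<close>. The resulting lower bound on
    \<open>m\<close> is largest for this \<open>c\<close>, for which \<open>2 / c\<close> is half of
    the left-hand side.\<close>
  define c where "c = 2 * exp (K / 2)"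
  have c: "c > 0" "1 / c = exp (- K / 2) / 2"
    by (simp_all add: c_def exp_minus field_simps)
  have int: "integrable M (\<lambda>w. exp (X w) * indicator (space M - A) w)"
    using A eX by (intro integrable_real_mult_indicator) auto
  have "2 * exp (- K / 2) * (1 + (X w + K) / 2)
      \<le> c * (indicator A w + exp (X w) * indicator (space M - A) w) + (1 / c) * (1 + exp (X w))"
    if "w \<in> space M" for w
  proof -
    have "2 * exp (- K / 2) * (1 + (X w + K) / 2) \<le> 2 * exp (- K / 2) * exp ((X w + K) / 2)"
      by (intro mult_left_mono exp_ge_add_one_self) auto
    also have "\<dots> = 2 * exp (X w / 2)"
      by (simp add: add_divide_distrib flip: exp_add)
    also have "\<dots> \<le> c * min 1 (exp (X w)) + (1 + exp (X w)) / c"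
      using exp_half_le[OF c(1)] by simp
    also have "min 1 (exp (X w)) \<le> indicator A w + exp (X w) * indicator (space M - A) w"
      using that by (auto simp: indicator_def)
    finally show ?thesis
      using c by simp
  qed
  then have "expectation (\<lambda>w. 2 * exp (- K / 2) * (1 + (X w + K) / 2))
      \<le> expectation (\<lambda>w. c * (indicator A w + exp (X w) * indicator (space M - A) w) + (1 / c) * (1 + exp (X w)))"
    using X eX A int by (intro integral_mono) (auto intro!: integrable_real_indicator simp: less_top[symmetric])
  also have "\<dots> = c * m + 2 / c"
    using X eX A int by (simp add: m_def prob_space less_top[symmetric])
  also have "expectation (\<lambda>w. 2 * exp (- K / 2) * (1 + (X w + K) / 2)) = 2 * exp (- K / 2)"
    using X by (simp add: prob_space)
  finally have "exp (- K / 2) \<le> c * m"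
    using c(2) by simp
  then have "exp (- K / 2) * exp (- K / 2) \<le> 2 * (exp (K / 2) * exp (- K / 2)) * m"
    by (simp add: c_def)
  then show ?thesis
    by (simp add: m_def flip: exp_add)
qed

section \<open>Policies as functions of the table: which entries matter, and measurability\<close>

lemma pulls_before_le: "pulls_before I j t w \<le> t - 1"
proof -
  have "pulls_before I j t w \<le> card {1..<t}"
    unfolding pulls_before_def by (intro card_mono) auto
  then show ?thesis
    by simp
qed

lemma pulls_before_eq_sum:
  "pulls_before I j t w = (\<Sum>s\<in>{1..<t}. if I s w = j then 1 else 0)"
  by (simp add: pulls_before_def sum.If_cases Int_def)

text \<open>The pull count before round \<open>s\<close> is the index of the entry read in round
  \<open>s\<close>. Hence all entries read before round \<open>t\<close> have indices below the pull
  counts before \<open>t\<close>.\<close>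

lemma pulls_before_strict:
  assumes "1 \<le> s" "s < t" "I s w = j"
  shows "pulls_before I j s w < pulls_before I j t w"
  unfolding pulls_before_def using assms by (intro psubset_card_mono) auto

text \<open>Every event of the generated sigma-algebra is a preimage under
  \<open>history I t\<close>, so none can separate two tables with the same history. The event used
  is that the arm is \<open>I t w\<close>.\<close>

lemma policy_history_cong:
  assumes "policy I" "1 \<le> t" "history I t w = history I t w'"
  shows "I t w = I t w'"
proof -
  have "I t \<in> vimage_algebra UNIV (history I t) (\<Pi>\<^sub>M s\<in>{1..<t}. borel) \<rightarrow>\<^sub>M count_space UNIV"
    using assms by (simp add: policy_def)
  from measurable_sets[OF this, of "{I t w}"]
  have "I t -` {I t w} \<in> sets (vimage_algebra UNIV (history I t) (\<Pi>\<^sub>M s\<in>{1..<t}. borel))"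
    by simp
  then obtain C where "I t -` {I t w} = history I t -` C"
    by (subst (asm) sets_vimage_algebra2) (auto simp: history_def space_PiM)
  then have "w \<in> I t -` {I t w} \<longleftrightarrow> w' \<in> I t -` {I t w}"
    using assms by simp
  then show ?thesis
    by simp
qed

text \<open>By induction on the round: equal arms so far give equal pull counts, so the same entries
  are read next, and these agree. Agreement is required only along the pull counts of
  \<open>w\<close>, so either of two tables can take the role of \<open>w\<close>.\<close>

lemma policy_cong:
  assumes "policy I" and agree: "\<And>j i. i < pulls_before I j t w \<Longrightarrow> w (j, i) = w' (j, i)"
    and "1 \<le> s" "s \<le> t"
  shows "I s w = I s w'"
  using \<open>1 \<le> s\<close> \<open>s \<le> t\<close>
proof (induction s rule: less_induct)
  case (less s)
  have "history I s w = history I s w'"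
    unfolding history_def
  proof (rule restrict_ext)
    fix r assume r: "r \<in> {1..<s}"
    have arm: "I q w = I q w'" if "1 \<le> q" "q \<le> r" for q
      using less r that by auto
    then have "pulls_before I j r w = pulls_before I j r w'" for j
      unfolding pulls_before_eq_sum by (intro sum.cong) auto
    then show "observed I r w = observed I r w'"
      using agree[of "pulls_before I (I r w) r w" "I r w"] pulls_before_strict[of r t I w] r less.prems arm[of r]
      by (simp add: observed_def)
  qed
  then show ?case
    by (rule policy_history_cong[OF \<open>policy I\<close> less.prems(1)])
qed

lemma measurable_pulls_before:
  assumes [measurable]: "\<And>s. 1 \<le> s \<Longrightarrow> s < t \<Longrightarrow> I s \<in> M \<rightarrow>\<^sub>M count_space UNIV"
  shows "pulls_before I j t \<in> M \<rightarrow>\<^sub>M count_space UNIV"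
proof -
  have "(\<lambda>w. \<Sum>s\<in>{1..<t}. if I s w = j then 1 else 0 :: nat) \<in> M \<rightarrow>\<^sub>M count_space UNIV"
    by (intro measurable_sum_nat) auto
  then show ?thesis
    by (simp add: pulls_before_eq_sum[abs_def])
qed

text \<open>\<open>policy\<close> gives measurability only with respect to the history. That the
  history is itself measurable in the table depends on the earlier arms, hence the
  induction.\<close>

lemma policy_measurable:
  assumes "policy I" "1 \<le> t"
  shows "I t \<in> PiM UNIV (\<lambda>_. borel) \<rightarrow>\<^sub>M count_space UNIV"
  using \<open>1 \<le> t\<close>
proof (induction t rule: less_induct)
  case (less t)
  let ?M = "PiM UNIV (\<lambda>_. borel) :: table measure"
  have "observed I s \<in> borel_measurable ?M" if s: "s \<in> {1..<t}" for s
  proof -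
    have I: "I q \<in> ?M \<rightarrow>\<^sub>M count_space UNIV" if "1 \<le> q" "q \<le> s" for q
      using less s that by auto
    \<comment> \<open>The index of the entry is random but has countably many values.\<close>
    have "(\<lambda>w. w (j, pulls_before I j s w)) \<in> borel_measurable ?M" for j
      by (rule measurable_compose_countable[OF _ measurable_pulls_before]) (use I in auto)
    moreover have "observed I s = (\<lambda>w. if I s w = Arm1 then w (Arm1, pulls_before I Arm1 s w)
        else w (Arm2, pulls_before I Arm2 s w))"
    proof
      show "observed I s w = (if I s w = Arm1 then w (Arm1, pulls_before I Arm1 s w)
        else w (Arm2, pulls_before I Arm2 s w))" for w
        by (cases "I s w") (simp_all add: observed_def)
    qed
    ultimately show ?thesis
      using I[of s] s by simp
  qed
  then have hist: "history I t \<in> ?M \<rightarrow>\<^sub>M (\<Pi>\<^sub>M s\<in>{1..<t}. borel)"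
    unfolding history_def by (intro measurable_restrict) auto
  have "vimage_algebra UNIV (history I t) (\<Pi>\<^sub>M s\<in>{1..<t}. borel) \<rightarrow>\<^sub>M count_space UNIV
      \<subseteq> ?M \<rightarrow>\<^sub>M count_space (UNIV :: arm set)"
  proof (rule measurable_mono)
    show "sets (vimage_algebra UNIV (history I t) (\<Pi>\<^sub>M s\<in>{1..<t}. borel)) \<subseteq> sets ?M"
      using measurable_sets[OF hist]
      by (subst sets_vimage_algebra2) (auto simp: history_def space_PiM)
  qed (auto simp: space_PiM)
  then show ?case
    using \<open>policy I\<close> less.prems by (auto simp: policy_def)
qed

(* If arm 2 is pulled at most k times before round t, then everything observed before round t
   lies in this finite block of the table. *)
definition block :: "nat \<Rightarrow> nat \<Rightarrow> (arm \<times> nat) set" where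
  "block t k = {Arm1} \<times> {..<t} \<union> {Arm2} \<times> {..<k}"

lemma finite_block: "finite (block t k)"
  by (simp add: block_def)

text \<open>As long as arm 2 has at most \<open>k\<close> pulls, nothing outside the block is read;
  arm 1 is covered in any case, having at most \<open>t - 1\<close> pulls. The bound may be known
  for either table, so that the event of at most \<open>k\<close> pulls can be transferred in both
  directions.\<close>

lemma policy_restrict_block:
  assumes "policy I" "pulls_before I Arm2 t w \<le> k \<or> pulls_before I Arm2 t (restrict w (block t k)) \<le> k"
  shows "\<And>s. 1 \<le> s \<Longrightarrow> s \<le> t \<Longrightarrow> I s (restrict w (block t k)) = I s w"
    and "pulls_before I j t (restrict w (block t k)) = pulls_before I j t w"
proof -
  have blk: "(j, i) \<in> block t k" if "i < pulls_before I j t v" "pulls_before I Arm2 t v \<le> k" for i j v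
    using that pulls_before_le[of I j t v] by (cases j) (auto simp: block_def)
  show I: "I s (restrict w (block t k)) = I s w" if "1 \<le> s" "s \<le> t" for s
    using assms(2)
  proof
    assume "pulls_before I Arm2 t w \<le> k"
    then show ?thesis
      using blk[of _ _ w] by (intro policy_cong[OF \<open>policy I\<close> _ that, symmetric]) simp
  next
    assume "pulls_before I Arm2 t (restrict w (block t k)) \<le> k"
    then show ?thesis
      using blk[of _ _ "restrict w (block t k)"] by (intro policy_cong[OF \<open>policy I\<close> _ that]) simp
  qed
  show "pulls_before I j t (restrict w (block t k)) = pulls_before I j t w"
    unfolding pulls_before_eq_sum by (intro sum.cong) (auto simp: I)
qed

text \<open>The stopping-time property: whether arm 2 is pulled more than \<open>k\<close> times is
  decided without looking at its entry of index \<open>k\<close>.\<close>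

lemma pulls_before_le_restrict_block:
  assumes "policy I"
  shows "pulls_before I Arm2 t (restrict w (block t k)) \<le> k \<longleftrightarrow> pulls_before I Arm2 t w \<le> k"
  using policy_restrict_block(2)[OF assms, of t w k Arm2] by metis

lemma prod_block:
  fixes g :: "arm \<times> nat \<Rightarrow> ennreal"
  assumes "\<And>i. g (Arm1, i) = 1"
  shows "(\<Prod>p\<in>block t k. g p) = (\<Prod>i<k. g (Arm2, i))"
proof -
  have "(\<Prod>p\<in>block t k. g p) = (\<Prod>p\<in>{Arm1} \<times> {..<t}. g p) * (\<Prod>p\<in>{Arm2} \<times> {..<k}. g p)"
    unfolding block_def by (intro prod.union_disjoint) auto
  also have "(\<Prod>p\<in>{Arm1} \<times> {..<t}. g p) = 1"
    using assms by (intro prod.neutral) auto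
  also have "(\<Prod>p\<in>{Arm2} \<times> {..<k}. g p) = (\<Prod>i<k. g (Arm2, i))"
    by (rule prod.reindex_bij_witness[of _ "\<lambda>i. (Arm2, i)" snd]) auto
  finally show ?thesis
    by simp
qed

section \<open>The two reward models\<close>

lemma prob_space_gaussian: "prob_space (gaussian m)"
  unfolding gaussian_def by (rule prob_space_normal_density) simp

lemma sets_gaussian [measurable_cong]: "sets (gaussian m) = sets borel"
  by (simp add: gaussian_def)

lemma
  shows integrable_gaussian_id: "integrable (gaussian m) (\<lambda>x. x)"
    and mean_gaussian: "mean (gaussian m) = m"
  unfolding gaussian_def mean_def
  using integrable_normal_moment_nz_1[of 1 m] integral_normal_moment_nz_1[of 1 m]
  by (simp_all add: integrable_density integral_density)

lemma mean_dirac0: "mean dirac0 = 0"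
  by (simp add: mean_def dirac0_def integral_return)

text \<open>The means are symmetric about 0, so the quadratic and constant terms of the two
  exponents cancel and the log-likelihood ratio is linear in \<open>x\<close>.\<close>

lemma gaussian_tilt: "gaussian \<Delta> = density (gaussian (- \<Delta>)) (\<lambda>x. ennreal (exp (2 * \<Delta> * x)))"
proof -
  have "normal_density \<Delta> 1 x = normal_density (- \<Delta>) 1 x * exp (2 * \<Delta> * x)" for x
    by (simp add: normal_density_def power2_eq_square field_simps flip: exp_add)
  then show ?thesis
    unfolding gaussian_def by (subst density_density_eq) (auto simp: ennreal_mult'' intro!: density_cong)
qed

lemma prob_space_arm: "prob_space (two_arms dirac0 (gaussian m) j)"
  by (cases j) (auto simp: two_arms_def dirac0_def prob_space_gaussian intro!: prob_space_return)

lemma sets_arm: "sets (two_arms dirac0 (gaussian m) j) = sets borel"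
  by (cases j) (auto simp: two_arms_def dirac0_def sets_gaussian)

lemma prob_space_bandit: "prob_space (bandit_measure (two_arms dirac0 (gaussian m)))"
  unfolding bandit_measure_def by (intro prob_space_PiM prob_space_arm)

lemma sets_bandit [measurable_cong]:
  "sets (bandit_measure (two_arms dirac0 (gaussian m))) = sets (PiM UNIV (\<lambda>_. borel))"
  unfolding bandit_measure_def by (intro sets_PiM_cong refl sets_arm)

lemma space_bandit [simp]: "space (bandit_measure (two_arms dirac0 (gaussian m))) = UNIV"
  using sets_eq_imp_space_eq[OF sets_bandit[of m]] by (simp add: space_PiM)

section \<open>The likelihood ratio of the observed rewards, Wald's identity and the testing
  bound\<close>

text \<open>The log-likelihood ratio of mean \<open>\<Delta>\<close> against mean
  \<open>- \<Delta>\<close> for the rewards observed before round \<open>t\<close>. Arm 1 has the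
  same law in both models and contributes nothing.\<close>

definition log_lr :: "real \<Rightarrow> (nat \<Rightarrow> table \<Rightarrow> arm) \<Rightarrow> nat \<Rightarrow> table \<Rightarrow> real" where
  "log_lr \<Delta> I t w = 2 * \<Delta> * (\<Sum>i<pulls_before I Arm2 t w. w (Arm2, i))"

text \<open>Trades the random number of summands for a fixed one, so that measurability and
  expectation can be treated term by term.\<close>

lemma log_lr_eq_sum:
  "log_lr \<Delta> I t w = 2 * \<Delta> * (\<Sum>i<t. indicator {w. i < pulls_before I Arm2 t w} w * w (Arm2, i))"
proof -
  have "{..<t} \<inter> {i. i < pulls_before I Arm2 t w} = {..<pulls_before I Arm2 t w}"
    using pulls_before_le[of I Arm2 t w] by auto
  then show ?thesis
    by (simp add: log_lr_def indicator_def of_bool_def if_distrib[of "\<lambda>x. x * _"] sum.If_cases cong: if_cong)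
qed

context
  fixes I :: "nat \<Rightarrow> table \<Rightarrow> arm" and t :: nat
  assumes policy: "policy I" and t: "1 \<le> t"
begin

lemma arm_measurable [measurable]: "I t \<in> PiM UNIV (\<lambda>_. borel) \<rightarrow>\<^sub>M count_space UNIV"
  using policy t by (rule policy_measurable)

lemma pulls_measurable [measurable]: "pulls_before I j t \<in> PiM UNIV (\<lambda>_. borel) \<rightarrow>\<^sub>M count_space UNIV"
  using policy by (intro measurable_pulls_before policy_measurable)

lemma arm_event [measurable]: "{w. I t w \<in> B} \<in> sets (PiM UNIV (\<lambda>_. borel))"
  using measurable_sets[OF arm_measurable, of B] by (simp add: vimage_def space_PiM)

lemma pulls_event [measurable]: "{w. pulls_before I j t w \<in> K} \<in> sets (PiM UNIV (\<lambda>_. borel))"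
  using measurable_sets[OF pulls_measurable, of K] by (simp add: vimage_def space_PiM)

lemma log_lr_measurable [measurable]: "log_lr \<Delta> I t \<in> borel_measurable (PiM UNIV (\<lambda>_. borel))"
  unfolding log_lr_eq_sum[abs_def] using pulls_event[of Arm2 "{i<..}" for i] by simp

text \<open>The number of observed rewards of arm 2 is random, so the event is cut into slices by
  the value \<open>k\<close> of that number. A slice depends only on the finite block
  \<open>block t k\<close>, whose product density equals \<open>exp (log_lr \<Delta> I t w)\<close>
  on the slice.\<close>

lemma bandit_change_of_measure:
  "emeasure (bandit_measure (two_arms dirac0 (gaussian \<Delta>))) {w. I t w \<in> B}
   = (\<integral>\<^sup>+w. ennreal (exp (log_lr \<Delta> I t w)) * indicator {w. I t w \<in> B} w
        \<partial>bandit_measure (two_arms dirac0 (gaussian (- \<Delta>))))" (is "emeasure ?M' ?A = ?R")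
proof -
  let ?M = "bandit_measure (two_arms dirac0 (gaussian (- \<Delta>)))"
  let ?T = "pulls_before I Arm2 t"
  let ?N = "\<lambda>p :: arm \<times> nat. two_arms dirac0 (gaussian (- \<Delta>)) (fst p)"
  define l :: "arm \<times> nat \<Rightarrow> real \<Rightarrow> ennreal"
    where "l p x = (case fst p of Arm1 \<Rightarrow> 1 | Arm2 \<Rightarrow> ennreal (exp (2 * \<Delta> * x)))" for p x
  have l: "l p \<in> borel_measurable borel" for p
    unfolding l_def by (cases "fst p") auto
  have D: "density (?N p) (l p) = two_arms dirac0 (gaussian \<Delta>) (fst p)" for p
    unfolding l_def two_arms_def by (cases "fst p") (simp_all add: density_1 gaussian_tilt[symmetric])
  have M': "?M' = PiM UNIV (\<lambda>p. density (?N p) (l p))"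
    by (simp add: bandit_measure_def D)
  define F where "F k w = (indicator {w. I t w \<in> B \<and> ?T w = k} w :: ennreal)" for k w
  have F[measurable]: "F k \<in> borel_measurable (PiM UNIV (\<lambda>_. borel))" for k
    unfolding F_def using sets.Int[OF arm_event[of B] pulls_event[of Arm2 "{k}"]]
    by (intro borel_measurable_indicator) (simp add: Int_def)
  \<comment> \<open>Slices with \<open>k < t\<close> suffice, since at most \<open>t - 1\<close>
    pulls precede round \<open>t\<close>.\<close>
  have A: "indicator ?A w = (\<Sum>k<t. F k w)" for w
    using pulls_before_le[of I Arm2 t w] t
    by (subst sum.cong[OF refl, of _ _ "\<lambda>k. if k = ?T w then indicator ?A w else 0"])
      (auto simp: F_def indicator_def)
  have step: "(\<integral>\<^sup>+w. F k w \<partial>?M') = (\<integral>\<^sup>+w. ennreal (exp (log_lr \<Delta> I t w)) * F k w \<partial>?M)" for k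
  proof -
    have dep: "F k (restrict w (block t k)) = F k w" for w
    proof (cases "?T w \<le> k")
      case True
      then have "I t (restrict w (block t k)) = I t w" "?T (restrict w (block t k)) = ?T w"
        using policy_restrict_block[OF policy, of t w k] t by blast+
      then show ?thesis
        by (simp add: F_def indicator_def)
    next
      \<comment> \<open>The restricted table may lead to other arms here, but its pull count also
        exceeds \<open>k\<close>, so both indicators vanish.\<close>
      case False
      then have "?T w \<noteq> k" "?T (restrict w (block t k)) \<noteq> k"
        using pulls_before_le_restrict_block[OF policy, of t w k] by auto
      then show ?thesis
        by (simp add: F_def)
    qed
    have "(\<integral>\<^sup>+w. F k w \<partial>PiM UNIV (\<lambda>p. density (?N p) (l p)))
        = (\<integral>\<^sup>+w. (\<Prod>p\<in>block t k. l p (w p)) * F k w \<partial>PiM UNIV ?N)"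
      by (rule nn_integral_PiM_change_of_measure)
        (simp_all add: prob_space_arm sets_arm finite_block l D F dep)
    then have "(\<integral>\<^sup>+w. F k w \<partial>?M') = (\<integral>\<^sup>+w. (\<Prod>p\<in>block t k. l p (w p)) * F k w \<partial>?M)"
      by (simp only: M' bandit_measure_def[of "two_arms dirac0 (gaussian (- \<Delta>))"])
    also have "\<dots> = (\<integral>\<^sup>+w. ennreal (exp (log_lr \<Delta> I t w)) * F k w \<partial>?M)"
    proof (rule nn_integral_cong)
      fix w
      have "(\<Prod>p\<in>block t k. l p (w p)) = ennreal (exp (2 * \<Delta> * (\<Sum>i<k. w (Arm2, i))))"
        by (subst prod_block) (simp_all add: l_def prod_ennreal exp_sum sum_distrib_left)
      then show "(\<Prod>p\<in>block t k. l p (w p)) * F k w = ennreal (exp (log_lr \<Delta> I t w)) * F k w"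
        by (auto simp: F_def indicator_def log_lr_def)
    qed
    finally show ?thesis .
  qed
  have "emeasure ?M' ?A = (\<integral>\<^sup>+w. indicator ?A w \<partial>?M')"
    by (intro nn_integral_indicator[symmetric]) measurable
  also have "\<dots> = (\<Sum>k<t. \<integral>\<^sup>+w. F k w \<partial>?M')"
    unfolding A by (intro nn_integral_sum) measurable
  also have "\<dots> = (\<integral>\<^sup>+w. (\<Sum>k<t. ennreal (exp (log_lr \<Delta> I t w)) * F k w) \<partial>?M)"
    unfolding step by (intro nn_integral_sum[symmetric]) measurable
  also have "\<dots> = ?R"
    unfolding A by (simp add: sum_distrib_left)
  finally show ?thesis .
qed

text \<open>Wald's identity. The reward of index \<open>i\<close> counts only if arm 2 has more than
  \<open>i\<close> pulls, an event independent of that reward, so each term contributes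
  \<open>- \<Delta>\<close> times a tail probability. The tail probabilities add up to the expected
  number of pulls.\<close>

lemma
  shows integrable_log_lr: "integrable (bandit_measure (two_arms dirac0 (gaussian (- \<Delta>)))) (log_lr \<Delta> I t)"
    and integral_log_lr: "(\<integral>w. log_lr \<Delta> I t w \<partial>bandit_measure (two_arms dirac0 (gaussian (- \<Delta>))))
      = - (2 * \<Delta>\<^sup>2 * (\<integral>w. real (pulls_before I Arm2 t w) \<partial>bandit_measure (two_arms dirac0 (gaussian (- \<Delta>)))))"
proof -
  let ?M = "bandit_measure (two_arms dirac0 (gaussian (- \<Delta>)))"
  let ?T = "pulls_before I Arm2 t"
  interpret prob_space ?M
    by (rule prob_space_bandit)
  let ?f = "\<lambda>i w. indicat_real {w. i < ?T w} w"
  have f: "integrable ?M (?f i)" for i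
    using pulls_event[of Arm2 "{i<..}"] by (intro integrable_real_indicator) (auto simp: less_top[symmetric] sets_bandit)
  have dep: "?f i (restrict w (block t i)) = ?f i w" for i w
    using pulls_before_le_restrict_block[OF policy, of t w i] by (auto simp: indicator_def not_le[symmetric])
  have mean: "(\<integral>x. x \<partial>gaussian (- \<Delta>)) = - \<Delta>"
    using mean_gaussian[of "- \<Delta>"] by (simp add: mean_def)
  note mult = integrable_PiM_mult_coordinate integral_PiM_mult_coordinate
  note mult = mult[where N="\<lambda>p :: arm \<times> nat. two_arms dirac0 (gaussian (- \<Delta>)) (fst p)" and h="\<lambda>x. x",
      OF prob_space_arm sets_arm, folded bandit_measure_def]
  have int: "integrable ?M (\<lambda>w. ?f i w * w (Arm2, i))" for i
    by (rule mult(1)[OF _ dep f]) (auto simp: block_def two_arms_def integrable_gaussian_id)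
  have val: "(\<integral>w. ?f i w * w (Arm2, i) \<partial>?M) = - \<Delta> * (\<integral>w. ?f i w \<partial>?M)" for i
    by (subst mult(2)[OF _ dep f]) (auto simp: block_def two_arms_def integrable_gaussian_id mean)
  show "integrable ?M (log_lr \<Delta> I t)"
    unfolding log_lr_eq_sum[abs_def]
    by (intro integrable_mult_right Bochner_Integration.integrable_sum int)
  have T: "real (?T w) = (\<Sum>i<t. ?f i w)" for w
  proof -
    have "{..<t} \<inter> {i. i < ?T w} = {..<?T w}"
      using pulls_before_le[of I Arm2 t w] by auto
    then show ?thesis
      by (simp add: indicator_def of_bool_def sum.If_cases)
  qed
  have "(\<integral>w. log_lr \<Delta> I t w \<partial>?M) = 2 * \<Delta> * (\<Sum>i<t. \<integral>w. ?f i w * w (Arm2, i) \<partial>?M)"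
    unfolding log_lr_eq_sum[abs_def]
    by (subst integral_mult_right_zero, subst Bochner_Integration.integral_sum) (rule int refl)+
  also have "\<dots> = - (2 * \<Delta>\<^sup>2 * (\<Sum>i<t. \<integral>w. ?f i w \<partial>?M))"
    unfolding val by (simp add: sum_distrib_left sum_negf power2_eq_square mult_ac)
  also have "(\<Sum>i<t. \<integral>w. ?f i w \<partial>?M) = (\<integral>w. real (?T w) \<partial>?M)"
    unfolding T using f by (intro Bochner_Integration.integral_sum[symmetric])
  finally show "(\<integral>w. log_lr \<Delta> I t w \<partial>?M) = - (2 * \<Delta>\<^sup>2 * (\<integral>w. real (?T w) \<partial>?M))" .
qed

text \<open>Bretagnolle-Huber for the test that decides by the arm chosen in round \<open>t\<close>:
  the two summands are the probabilities of the wrong arm in each model. The change of measure turns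
  the second one into an expectation under the first model.\<close>

lemma two_point_bound:
  "exp (- (2 * \<Delta>\<^sup>2 * (\<integral>w. real (pulls_before I Arm2 t w) \<partial>bandit_measure (two_arms dirac0 (gaussian (- \<Delta>)))))) / 2
   \<le> measure (bandit_measure (two_arms dirac0 (gaussian (- \<Delta>)))) {w. I t w = Arm2}
     + measure (bandit_measure (two_arms dirac0 (gaussian \<Delta>))) {w. I t w = Arm1}"
proof -
  let ?M = "bandit_measure (two_arms dirac0 (gaussian (- \<Delta>)))"
  let ?M' = "bandit_measure (two_arms dirac0 (gaussian \<Delta>))"
  let ?L = "\<lambda>w. exp (log_lr \<Delta> I t w)"
  interpret prob_space ?M
    by (rule prob_space_bandit)
  interpret M': prob_space ?M'
    by (rule prob_space_bandit)
  \<comment> \<open>With \<open>B = UNIV\<close> the change of measure states that the likelihood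
    ratio has total mass 1.\<close>
  have "has_bochner_integral ?M ?L 1"
    using bandit_change_of_measure[of \<Delta> UNIV] M'.emeasure_space_1
    by (intro has_bochner_integral_nn_integral) auto
  then have L: "integrable ?M ?L" "expectation ?L = 1"
    by (auto simp: has_bochner_integral_iff)
  have ev: "{w. I t w = Arm2} \<in> events"
    using arm_event[of "{Arm2}"] by (simp add: sets_bandit)
  have "{w. I t w \<in> {Arm1}} = UNIV - {w. I t w = Arm2}"
    by (auto intro: arm.exhaust)
  then have "emeasure ?M' {w. I t w = Arm1} = (\<integral>\<^sup>+w. ennreal (?L w * indicator (UNIV - {w. I t w = Arm2}) w) \<partial>?M)"
    using bandit_change_of_measure[of \<Delta> "{Arm1}"] by (auto intro!: nn_integral_cong simp: indicator_def)
  also have "\<dots> = ennreal (expectation (\<lambda>w. ?L w * indicator (UNIV - {w. I t w = Arm2}) w))"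
    using sets.compl_sets[OF ev] L by (intro nn_integral_eq_integral integrable_real_mult_indicator) auto
  finally have "measure ?M' {w. I t w = Arm1} = expectation (\<lambda>w. ?L w * indicator (space ?M - {w. I t w = Arm2}) w)"
    by (simp add: measure_def)
  then show ?thesis
    using bretagnolle_huber[OF integrable_log_lr integral_log_lr L ev] by simp
qed

end

section \<open>Regret as a count of wrong pulls, and the lower bound\<close>

text \<open>The assumption on \<open>j\<close> says that it is the inferior arm, with gap
  \<open>\<bar>m\<bar>\<close>. In this form one lemma serves both models, with \<open>Arm2\<close>
  for \<open>- \<Delta>\<close> and \<open>Arm1\<close> for \<open>\<Delta>\<close>.\<close>

lemma regret_two_arms:
  assumes "policy I" and j: "\<And>w. max 0 m - mean (two_arms dirac0 (gaussian m) w) = \<bar>m\<bar> * (if w = j then 1 else 0)"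
  shows "regret (two_arms dirac0 (gaussian m)) I n
    = \<bar>m\<bar> * (\<Sum>t=1..n. measure (bandit_measure (two_arms dirac0 (gaussian m))) {w. I t w = j})"
proof -
  let ?M = "bandit_measure (two_arms dirac0 (gaussian m))"
  interpret prob_space ?M
    by (rule prob_space_bandit)
  have "(\<integral>w. mean (two_arms dirac0 (gaussian m) (I t w)) \<partial>?M) = max 0 m - \<bar>m\<bar> * prob {w. I t w = j}"
    if "t \<in> {1..n}" for t
  proof -
    have "{w. I t w = j} \<in> events"
      using arm_event[of I t "{j}"] assms that by (simp add: sets_bandit)
    moreover have "mean (two_arms dirac0 (gaussian m) (I t w)) = max 0 m - \<bar>m\<bar> * indicator {w. I t w = j} w" for w
      using j[of "I t w"] by (auto simp: indicator_def split: if_splits)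
    ultimately show ?thesis
      using prob_space by (simp add: less_top[symmetric])
  qed
  then show ?thesis
    by (simp add: regret_def two_arms_def mean_dirac0 mean_gaussian sum_subtractf sum_distrib_left)
qed

lemma integral_pulls_before:
  assumes "policy I"
  shows "(\<integral>w. real (pulls_before I j t w) \<partial>bandit_measure (two_arms dirac0 (gaussian m)))
    = (\<Sum>s\<in>{1..<t}. measure (bandit_measure (two_arms dirac0 (gaussian m))) {w. I s w = j})"
proof -
  let ?M = "bandit_measure (two_arms dirac0 (gaussian m))"
  interpret prob_space ?M
    by (rule prob_space_bandit)
  have "{w. I s w = j} \<in> events" if "s \<in> {1..<t}" for s
    using arm_event[of I s "{j}"] assms that by (simp add: sets_bandit)
  moreover have "(\<integral>w. real (pulls_before I j t w) \<partial>?M) = (\<integral>w. (\<Sum>s\<in>{1..<t}. indicator {w. I s w = j} w) \<partial>?M)"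
    by (intro Bochner_Integration.integral_cong refl)
      (simp add: pulls_before_eq_sum indicator_def of_bool_def if_distrib[of real] cong: if_cong)
  ultimately show ?thesis
    by (simp add: less_top[symmetric])
qed

theorem theorem6:
  fixes \<Delta> :: real and \<nu> \<nu>' :: "arm \<Rightarrow> real measure"
    and I :: "nat \<Rightarrow> table \<Rightarrow> arm" and n :: nat
  assumes "\<Delta> > 0"
    and "\<nu> = two_arms dirac0 (gaussian (- \<Delta>))"
    and "\<nu>' = two_arms dirac0 (gaussian \<Delta>)"
    and "policy I"
    and "n \<ge> 1"
  shows "max (regret \<nu> I n) (regret \<nu>' I n) \<ge> ln (real n * \<Delta>\<^sup>2 / 2) / (4 * \<Delta>)"
proof -
  let ?M = "bandit_measure \<nu>" and ?M' = "bandit_measure \<nu>'"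
  define R where "R = max (regret \<nu> I n) (regret \<nu>' I n)"
  have r: "regret \<nu> I n = \<Delta> * (\<Sum>t=1..n. measure ?M {w. I t w = Arm2})"
    using assms(1) regret_two_arms[OF \<open>policy I\<close>, of "- \<Delta>" Arm2 n] unfolding assms(2)
    by (auto simp: two_arms_def mean_dirac0 mean_gaussian split: arm.split)
  have r': "regret \<nu>' I n = \<Delta> * (\<Sum>t=1..n. measure ?M' {w. I t w = Arm1})"
    using assms(1) regret_two_arms[OF \<open>policy I\<close>, of \<Delta> Arm1 n] unfolding assms(3)
    by (auto simp: two_arms_def mean_dirac0 mean_gaussian split: arm.split)
  have step: "exp (- (2 * \<Delta> * R)) / 2 \<le> measure ?M {w. I t w = Arm2} + measure ?M' {w. I t w = Arm1}"
    if "t \<in> {1..n}" for t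
  proof -
    have "\<Delta> * (\<integral>w. real (pulls_before I Arm2 t w) \<partial>?M) = \<Delta> * (\<Sum>s\<in>{1..<t}. measure ?M {w. I s w = Arm2})"
      unfolding assms(2) by (simp add: integral_pulls_before[OF \<open>policy I\<close>])
    \<comment> \<open>The rounds before \<open>t\<close> are among the \<open>n\<close> rounds, so
      the bound on the divergence is uniform in \<open>t\<close>.\<close>
    also have "\<dots> \<le> regret \<nu> I n"
      unfolding r using that assms(1) by (intro mult_left_mono sum_mono2) auto
    also have "\<dots> \<le> R"
      by (simp add: R_def)
    finally have "2 * \<Delta> * (\<Delta> * (\<integral>w. real (pulls_before I Arm2 t w) \<partial>?M)) \<le> 2 * \<Delta> * R"
      using assms(1) by (intro mult_left_mono) auto
    then have "exp (- (2 * \<Delta> * R)) / 2 \<le> exp (- (2 * \<Delta>\<^sup>2 * (\<integral>w. real (pulls_before I Arm2 t w) \<partial>?M))) / 2"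
      by (simp add: power2_eq_square mult_ac)
    also have "\<dots> \<le> measure ?M {w. I t w = Arm2} + measure ?M' {w. I t w = Arm1}"
      using two_point_bound[OF \<open>policy I\<close>, of t \<Delta>] that unfolding assms(2,3) by simp
    finally show ?thesis .
  qed
  have "real n * (exp (- (2 * \<Delta> * R)) / 2)
      \<le> (\<Sum>t=1..n. measure ?M {w. I t w = Arm2} + measure ?M' {w. I t w = Arm1})"
    using sum_mono[OF step, of "{1..n}"] by simp
  then have "\<Delta> * (real n * (exp (- (2 * \<Delta> * R)) / 2)) \<le> regret \<nu> I n + regret \<nu>' I n"
    using assms(1) unfolding r r' by (simp add: sum.distrib flip: distrib_left)
  also have "\<dots> \<le> 2 * R"
    by (auto simp: R_def)
  finally have "\<Delta> * real n * exp (- (2 * \<Delta> * R)) \<le> 4 * R"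
    by simp
  \<comment> \<open>One more factor \<open>\<Delta>\<close> turns the regret into the quantity
    \<open>2 * \<Delta> * R\<close> that already stands in the exponent.\<close>
  then have "\<Delta> * (\<Delta> * real n * exp (- (2 * \<Delta> * R))) \<le> \<Delta> * (4 * R)"
    using assms(1) by (intro mult_left_mono) auto
  then have "real n * \<Delta>\<^sup>2 / 2 * exp (- (2 * \<Delta> * R)) \<le> 2 * \<Delta> * R"
    by (simp add: power2_eq_square mult_ac)
  also have "\<dots> \<le> exp (2 * \<Delta> * R)"
    using exp_ge_add_one_self[of "2 * \<Delta> * R"] by linarith
  finally have "real n * \<Delta>\<^sup>2 / 2 * exp (- (2 * \<Delta> * R)) * exp (2 * \<Delta> * R) \<le> exp (2 * \<Delta> * R) * exp (2 * \<Delta> * R)"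
    by (intro mult_right_mono) auto
  then have "real n * \<Delta>\<^sup>2 / 2 \<le> exp (R * (4 * \<Delta>))"
    by (simp add: mult.assoc mult.left_commute[of R] mult.commute[of R] flip: exp_add)
  then have "ln (real n * \<Delta>\<^sup>2 / 2) \<le> ln (exp (R * (4 * \<Delta>)))"
    using assms(1,5) by (intro ln_mono) auto
  then show ?thesis
    using assms(1) by (simp add: R_def[symmetric] pos_divide_le_eq)
qed

end
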